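(* If a $B_1$-algebra $A$ is laskerian, then it has the Evans property.
   Context: A $B_1$-algebra (characteristic one semiring) is a commutative semiring $A$ with $0$ (neutral for addition and absorbing for multiplication) and $1$, such that $1+1=1$ (hence $x+x=x$ for all $x\in A$). An ideal of $A$ is a subset containing $0$, closed under addition, and closed under multiplication by elements of $A$. The saturation of an ideal $I$ is $\overline{I}=\{x\in A\mid \exists y\in I,\ x+y=y\}$, which is an ideal; $I$ is saturated if $I=\overline{I}$. An ideal $\mathcal{P}$ is prime if $\mathcal{P}\neq A$ and $xy\in\mathcal{P}$ implies $x\in\mathcal{P}$ or $y\in\mathcal{P}$. An ideal $\mathcal{Q}$ is primary if $\mathcal{Q}\neq A$ and, for all $x,y\in A$, $xy\in\mathcal{Q}$ implies $x\in\mathcal{Q}$ or $y^n\in\mathcal{Q}$ for some $n\geq 1$. $A$ is laskerian if any saturated ideal of $A$ can be expressed as a finite intersection of saturated primary ideals (the empty intersection being $A$). For an ideal $I$ of $A$, let $\mathcal{D}_A(I)=\{x\in A\mid \exists y\notin I,\ xy\in I\}$. $A$ has the Evans property if, for each saturated ideal $I$ of $A$, $\mathcal{D}_A(I)$ is a finite union of saturated prime ideals of $A$ (the empty union being $\emptyset$). *)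

theory Defs
  imports Main
begin

text \<open>
  The class \<^class>\<open>comm_semiring_1\<close> assumes \<open>0 \<noteq> 1\<close>. The superclasses below do not, so the trivial
  semiring is allowed.
\<close>

class b1_algebra = comm_semiring_0 + comm_monoid_mult +
  assumes one_add_one_eq_one: "1 + 1 = 1"

definition semiring_ideal :: "'a::b1_algebra set \<Rightarrow> bool" where
  "semiring_ideal I \<longleftrightarrow>
     0 \<in> I \<and> (\<forall>x\<in>I. \<forall>y\<in>I. x + y \<in> I) \<and> (\<forall>a. \<forall>x\<in>I. a * x \<in> I)"

definition saturation :: "'a::b1_algebra set \<Rightarrow> 'a set" where
  "saturation I = {x. \<exists>y\<in>I. x + y = y}"

definition saturated_ideal :: "'a::b1_algebra set \<Rightarrow> bool" where
  "saturated_ideal I \<longleftrightarrow> semiring_ideal I \<and> I = saturation I"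

definition prime_ideal :: "'a::b1_algebra set \<Rightarrow> bool" where
  "prime_ideal P \<longleftrightarrow>
     semiring_ideal P \<and> P \<noteq> UNIV \<and> (\<forall>x y. x * y \<in> P \<longrightarrow> x \<in> P \<or> y \<in> P)"

definition primary_ideal :: "'a::b1_algebra set \<Rightarrow> bool" where
  "primary_ideal Q \<longleftrightarrow>
     semiring_ideal Q \<and> Q \<noteq> UNIV \<and>
     (\<forall>x y. x * y \<in> Q \<longrightarrow> x \<in> Q \<or> (\<exists>n\<ge>1. y ^ n \<in> Q))"

text \<open>
  In the next definition \<open>\<Inter>{} = UNIV\<close>, the whole algebra; in \<open>evans_property\<close> below,
  \<open>\<Union>{} = {}\<close>.
\<close>

definition laskerian :: "'a::b1_algebra itself \<Rightarrow> bool" where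
  "laskerian TYPE('a) \<longleftrightarrow>
     (\<forall>I::'a set. saturated_ideal I \<longrightarrow>
        (\<exists>F. finite F \<and> (\<forall>Q\<in>F. saturated_ideal Q \<and> primary_ideal Q) \<and> I = \<Inter>F))"

definition zero_divisors_mod :: "'a::b1_algebra set \<Rightarrow> 'a set" where
  "zero_divisors_mod I = {x. \<exists>y. y \<notin> I \<and> x * y \<in> I}"

definition evans_property :: "'a::b1_algebra itself \<Rightarrow> bool" where
  "evans_property TYPE('a) \<longleftrightarrow>
     (\<forall>I::'a set. saturated_ideal I \<longrightarrow>
        (\<exists>F. finite F \<and> (\<forall>P\<in>F. saturated_ideal P \<and> prime_ideal P) \<and> zero_divisors_mod I = \<Union>F))"

end

theory Submission
  imports Defs
begin

text \<open>
  Take an irredundant finite decomposition of \<open>I\<close> into saturated primary ideals \<open>Q\<close>. Then the zero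
  divisors modulo \<open>I\<close> are exactly the union of the radicals of the \<open>Q\<close>, and these radicals are
  saturated primes. For the nontrivial inclusion, let \<open>x\<close> lie in the radical of \<open>Q\<close> and choose \<open>y\<close>
  outside \<open>Q\<close> in all other components: some \<open>x\<^sup>n y\<close> lies in \<open>I\<close>, and for the least such \<open>n\<close> the
  element \<open>x\<^sup>n\<^sup>-\<^sup>1 y\<close> witnesses that \<open>x\<close> is a zero divisor modulo \<open>I\<close>. Distinct components may have
  the same radical, so no uniqueness of the decomposition is needed.
\<close>

text \<open>Allowing \<open>n = 0\<close> is harmless: for an ideal, \<open>x ^ n \<in> I\<close>
  gives \<open>x ^ Suc n \<in> I\<close>, so this is the usual radical.\<close>

definition radical :: "'a::b1_algebra set \<Rightarrow> 'a set" where
  "radical I = {x. \<exists>n. x ^ n \<in> I}"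

lemma add_idem: "x + x = (x :: 'a::b1_algebra)"
  by (metis distrib_left mult_1_right one_add_one_eq_one)

lemma semiring_ideal_zero: "semiring_ideal I \<Longrightarrow> 0 \<in> I"
  and semiring_ideal_add: "semiring_ideal I \<Longrightarrow> x \<in> I \<Longrightarrow> y \<in> I \<Longrightarrow> x + y \<in> I"
  and semiring_ideal_mult: "semiring_ideal I \<Longrightarrow> x \<in> I \<Longrightarrow> a * x \<in> I"
  by (auto simp: semiring_ideal_def)

lemma semiring_ideal_one_notin: "semiring_ideal I \<Longrightarrow> I \<noteq> UNIV \<Longrightarrow> 1 \<notin> I"
  by (metis UNIV_eq_I mult_1_right semiring_ideal_mult)

lemma saturated_idealD: "saturated_ideal I \<Longrightarrow> y \<in> I \<Longrightarrow> x + y = y \<Longrightarrow> x \<in> I"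
  by (auto simp: saturated_ideal_def saturation_def)

text \<open>Any \<open>I\<close> lies in its saturation because addition is idempotent, so only the
  other inclusion is left to check.\<close>

lemma saturated_idealI:
  assumes "semiring_ideal I" "\<And>x y. y \<in> I \<Longrightarrow> x + y = y \<Longrightarrow> x \<in> I"
  shows "saturated_ideal I"
  using assms add_idem by (auto simp: saturated_ideal_def saturation_def)

text \<open>The factor \<open>z\<close> makes the induction on \<open>n + m\<close> work without the binomial theorem.\<close>

lemma semiring_ideal_mult_add_power:
  assumes "semiring_ideal I" "z * x ^ n \<in> I" "z * y ^ m \<in> I"
  shows "z * (x + y) ^ (n + m) \<in> I"
  using assms(2,3)
proof (induction "n + m" arbitrary: n m z)
  case 0
  then show ?case by simp
next
  case (Suc k)
  show ?case
  proof (cases "n = 0 \<or> m = 0")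
    case True
    then have "z \<in> I"
      using Suc.prems by auto
    then show ?thesis
      by (metis assms(1) mult.commute semiring_ideal_mult)
  next
    case False
    then obtain n' m' where nm: "n = Suc n'" "m = Suc m'"
      by (meson not0_implies_Suc)
    \<comment> \<open>One factor \<open>x + y\<close> is split off the power and each summand joins
      \<open>z\<close>; the exponent pairs \<open>(n', m)\<close> and \<open>(n, m')\<close> both
      sum to \<open>k\<close>.\<close>
    have "(z * x) * x ^ n' \<in> I" "(z * y) * y ^ m' \<in> I"
      using Suc.prems nm by (simp_all add: mult.assoc)
    moreover have "(z * x) * y ^ m \<in> I" "(z * y) * x ^ n \<in> I"
      using semiring_ideal_mult[OF assms(1)] Suc.prems by (metis mult.commute mult.left_commute)+
    ultimately have "(z * x) * (x + y) ^ (n' + m) \<in> I" "(z * y) * (x + y) ^ (n + m') \<in> I"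
      using Suc.hyps(1)[of n' m "z * x"] Suc.hyps(1)[of n m' "z * y"] Suc.hyps(2) nm by auto
    then have "(z * x) * (x + y) ^ (n' + m) + (z * y) * (x + y) ^ (n + m') \<in> I"
      by (rule semiring_ideal_add[OF assms(1)])
    moreover have "z * (x + y) ^ (n + m)
        = (z * x) * (x + y) ^ (n' + m) + (z * y) * (x + y) ^ (n + m')"
      by (simp add: nm distrib_left distrib_right ac_simps)
    ultimately show ?thesis by simp
  qed
qed

text \<open>The hypothesis puts \<open>x\<close> below \<open>y\<close> in the natural order, for
  which multiplication is monotone. This lets radicals inherit saturation.\<close>

lemma power_absorb:
  fixes x y :: "'a::b1_algebra"
  assumes "x + y = y"
  shows "x ^ n + y ^ n = y ^ n"
proof (induction n)
  case 0
  show ?case by (simp add: one_add_one_eq_one)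
next
  case (Suc n)
  have "y ^ Suc n = (x + y) * (x ^ n + y ^ n)"
    by (simp add: Suc assms)
  also have "\<dots> = x ^ Suc n + (x * y ^ n + y * (x ^ n + y ^ n))"
    by (simp add: distrib_left distrib_right ac_simps)
  \<comment> \<open>Since \<open>x ^ Suc n\<close> is a summand of \<open>y ^ Suc n\<close>, adding
    it again changes nothing.\<close>
  finally show ?case
    by (metis add.assoc add_idem)
qed

lemma semiring_ideal_radical:
  assumes "semiring_ideal I"
  shows "semiring_ideal (radical I)"
  unfolding semiring_ideal_def
proof (intro conjI ballI allI)
  show "0 \<in> radical I"
    using semiring_ideal_zero[OF assms] by (auto simp: radical_def intro: exI[of _ 1])
  show "x + y \<in> radical I" if "x \<in> radical I" "y \<in> radical I" for x y
    using that semiring_ideal_mult_add_power[OF assms, of 1 x _ y] by (auto simp: radical_def)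
  show "a * x \<in> radical I" if "x \<in> radical I" for a x
    using that semiring_ideal_mult[OF assms] by (auto simp: radical_def power_mult_distrib)
qed

lemma saturated_ideal_radical:
  assumes "saturated_ideal I"
  shows "saturated_ideal (radical I)"
proof (rule saturated_idealI)
  show "semiring_ideal (radical I)"
    using assms semiring_ideal_radical by (auto simp: saturated_ideal_def)
  show "x \<in> radical I" if "y \<in> radical I" "x + y = y" for x y
    using that power_absorb saturated_idealD[OF assms] by (force simp: radical_def)
qed

lemma primary_idealD:
  assumes "primary_ideal Q" "x * y \<in> Q" "x \<notin> Q"
  shows "y \<in> radical Q"
  using assms by (auto simp: primary_ideal_def radical_def)

text \<open>If \<open>x ^ n * y ^ n\<close> is in \<open>Q\<close> but \<open>x ^ n\<close> is not,
  some power of \<open>y ^ n\<close>, hence of \<open>y\<close>, is in \<open>Q\<close>.\<close>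

lemma prime_ideal_radical:
  assumes "primary_ideal Q"
  shows "prime_ideal (radical Q)"
  unfolding prime_ideal_def
proof (intro conjI allI impI)
  have Q: "semiring_ideal Q" "Q \<noteq> UNIV"
    using assms by (auto simp: primary_ideal_def)
  show "semiring_ideal (radical Q)"
    using Q semiring_ideal_radical by blast
  have "1 \<notin> radical Q"
    using semiring_ideal_one_notin[OF Q] by (simp add: radical_def)
  then show "radical Q \<noteq> UNIV" by blast
  fix x y
  assume "x * y \<in> radical Q"
  then obtain n where "x ^ n * y ^ n \<in> Q"
    by (auto simp: radical_def power_mult_distrib)
  then have "x ^ n \<in> Q \<or> y ^ n \<in> radical Q"
    using assms primary_idealD by blast
  then show "x \<in> radical Q \<or> y \<in> radical Q"
    by (auto simp: radical_def simp flip: power_mult)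
qed

text \<open>An inclusion-minimal subfamily with the same intersection works: a member containing the
  intersection of the others could be dropped.\<close>

lemma irredundant_Inter:
  assumes "finite F"
  obtains G where "G \<subseteq> F" "\<Inter>G = \<Inter>F" "\<And>Q. Q \<in> G \<Longrightarrow> \<exists>y. y \<notin> Q \<and> y \<in> \<Inter>(G - {Q})"
proof -
  have "finite {G \<in> Pow F. \<Inter>G = \<Inter>F}" "F \<in> {G \<in> Pow F. \<Inter>G = \<Inter>F}"
    using assms by auto
  then obtain G where G: "G \<subseteq> F" "\<Inter>G = \<Inter>F"
    and min: "\<And>H. H \<subseteq> F \<Longrightarrow> \<Inter>H = \<Inter>F \<Longrightarrow> H \<subseteq> G \<Longrightarrow> G = H"
    using finite_has_minimal2[of "{G \<in> Pow F. \<Inter>G = \<Inter>F}" F] by auto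
  have "\<exists>y. y \<notin> Q \<and> y \<in> \<Inter>(G - {Q})" if "Q \<in> G" for Q
  proof (rule ccontr)
    assume "\<nexists>y. y \<notin> Q \<and> y \<in> \<Inter>(G - {Q})"
    then have "\<Inter>(G - {Q}) = \<Inter>G"
      using that by blast
    then have "G = G - {Q}"
      using min G by (metis Diff_subset subset_trans)
    then show False
      using that by blast
  qed
  then show thesis
    using that G by blast
qed

lemma zero_divisors_mod_Inter_primary:
  assumes primary: "\<And>Q. Q \<in> G \<Longrightarrow> primary_ideal Q"
    and irredundant: "\<And>Q. Q \<in> G \<Longrightarrow> \<exists>y. y \<notin> Q \<and> y \<in> \<Inter>(G - {Q})"
  shows "zero_divisors_mod (\<Inter>G) = \<Union>(radical ` G)"
proof (intro equalityI subsetI)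
  fix x assume "x \<in> zero_divisors_mod (\<Inter>G)"
  \<comment> \<open>\<open>Q\<close> is a component that the witness \<open>y\<close> misses;
    primariness then applies with \<open>y\<close> as the factor outside \<open>Q\<close>.\<close>
  then obtain y Q where "Q \<in> G" "y \<notin> Q" "y * x \<in> Q"
    by (auto simp: zero_divisors_mod_def mult.commute)
  then show "x \<in> \<Union>(radical ` G)"
    using primary primary_idealD by blast
next
  fix x assume "x \<in> \<Union>(radical ` G)"
  then obtain Q n where Q: "Q \<in> G" "x ^ n \<in> Q"
    by (auto simp: radical_def)
  obtain y where y: "y \<notin> Q" "y \<in> \<Inter>(G - {Q})"
    using irredundant Q(1) by blast
  have ideal: "semiring_ideal R" if "R \<in> G" for R
    using primary that by (auto simp: primary_ideal_def)
  \<comment> \<open>The factor \<open>x ^ n\<close> handles \<open>Q\<close>, and \<open>y\<close>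
    handles every other component.\<close>
  have "x ^ n * y \<in> R" if "R \<in> G" for R
  proof (cases "R = Q")
    case True
    then show ?thesis
      using semiring_ideal_mult[OF ideal[OF that], of "x ^ n" y] Q(2) by (simp add: mult.commute)
  next
    case False
    then show ?thesis
      using semiring_ideal_mult[OF ideal[OF that]] y(2) that by blast
  qed
  then have "x ^ n * y \<in> \<Inter>G" by blast
  moreover have "x ^ 0 * y \<notin> \<Inter>G"
    using y(1) Q(1) by auto
  \<comment> \<open>Membership fails at exponent 0 and holds at \<open>n\<close>, so it switches on
    somewhere; \<open>x ^ k * y\<close> just before is the witness.\<close>
  ultimately obtain k where "x ^ k * y \<notin> \<Inter>G" "x ^ Suc k * y \<in> \<Inter>G"
    using ex_least_nat_less[of "\<lambda>k. x ^ k * y \<in> \<Inter>G" n] by blast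
  then show "x \<in> zero_divisors_mod (\<Inter>G)"
    unfolding zero_divisors_mod_def by (auto simp only: power_Suc mult.assoc)
qed

theorem theorem7p3:
  assumes "laskerian TYPE('a::b1_algebra)"
  shows "evans_property TYPE('a)"
  unfolding evans_property_def
proof (intro allI impI)
  fix I :: "'a set"
  assume "saturated_ideal I"
  \<comment> \<open>For \<open>I = UNIV\<close> the family is empty, as primary ideals are proper,
    and so is the resulting union of primes.\<close>
  then obtain F where F: "finite F" "\<And>Q. Q \<in> F \<Longrightarrow> saturated_ideal Q \<and> primary_ideal Q" "I = \<Inter>F"
    using assms unfolding laskerian_def by blast
  obtain G where G: "G \<subseteq> F" "\<Inter>G = \<Inter>F" "\<And>Q. Q \<in> G \<Longrightarrow> \<exists>y. y \<notin> Q \<and> y \<in> \<Inter>(G - {Q})"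
    using irredundant_Inter[OF F(1)] by blast
  have "zero_divisors_mod (\<Inter>G) = \<Union>(radical ` G)"
    using F(2) G(1) by (intro zero_divisors_mod_Inter_primary G(3)) auto
  moreover have "finite (radical ` G)"
    using F(1) G(1) finite_subset by blast
  moreover have "\<forall>P\<in>radical ` G. saturated_ideal P \<and> prime_ideal P"
    using F(2) G(1) saturated_ideal_radical prime_ideal_radical by blast
  ultimately show "\<exists>H. finite H \<and> (\<forall>P\<in>H. saturated_ideal P \<and> prime_ideal P) \<and>
      zero_divisors_mod I = \<Union>H"
    using F(3) G(2) by metis
qed

end
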